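(* Let $G$ and $H$ be profinite groups and suppose there is an $o$-projectivity from $G$ onto $H$. If $G$ is topologically finitely generated, then $H$ is topologically finitely generated as well.
   Context: For a profinite group $G$, $\mathcal{L}_o(G)$ is the lattice of all open subgroups of $G$, with meet the intersection and join $\langle X,Y\rangle$. An $o$-projectivity from a profinite group $G$ onto a profinite group $H$ is a lattice isomorphism from $\mathcal{L}_o(G)$ onto $\mathcal{L}_o(H)$. A profinite group is topologically finitely generated if it is the closure of a finitely generated (abstract) subgroup. *)

theory Defs
  imports "HOL-Analysis.Analysis" "HOL-Algebra.Generated_Groups"
begin

definition topological_group :: "('a, 'c) monoid_scheme \<Rightarrow> 'a topology \<Rightarrow> bool" where
  "topological_group G T \<longleftrightarrow>
     group G \<and> topspace T = carrier G \<and>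
     continuous_map (prod_topology T T) T (\<lambda>(x, y). x \<otimes>\<^bsub>G\<^esub> y) \<and>
     continuous_map T T (\<lambda>x. inv\<^bsub>G\<^esub> x)"

definition totally_disconnected_space :: "'a topology \<Rightarrow> bool" where
  "totally_disconnected_space T \<longleftrightarrow>
     (\<forall>x\<in>topspace T. connected_component_of_set T x = {x})"

definition profinite_group :: "('a, 'c) monoid_scheme \<Rightarrow> 'a topology \<Rightarrow> bool" where
  "profinite_group G T \<longleftrightarrow>
     topological_group G T \<and> compact_space T \<and> Hausdorff_space T \<and>
     totally_disconnected_space T"

definition open_subgroups :: "('a, 'c) monoid_scheme \<Rightarrow> 'a topology \<Rightarrow> 'a set set" where
  "open_subgroups G T = {X. subgroup X G \<and> openin T X}"

text \<open>The join of two open subgroups is the abstract subgroup they generate. It contains an open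
  subgroup, hence is itself open, and no closure is needed.\<close>

definition o_projectivity ::
  "('a, 'c) monoid_scheme \<Rightarrow> 'a topology \<Rightarrow> ('b, 'd) monoid_scheme \<Rightarrow> 'b topology
    \<Rightarrow> ('a set \<Rightarrow> 'b set) \<Rightarrow> bool" where
  "o_projectivity G T H U \<phi> \<longleftrightarrow>
     bij_betw \<phi> (open_subgroups G T) (open_subgroups H U) \<and>
     (\<forall>X\<in>open_subgroups G T. \<forall>Y\<in>open_subgroups G T.
        \<phi> (X \<inter> Y) = \<phi> X \<inter> \<phi> Y \<and>
        \<phi> (generate G (X \<union> Y)) = generate H (\<phi> X \<union> \<phi> Y))"

definition topologically_finitely_generated ::
  "('a, 'c) monoid_scheme \<Rightarrow> 'a topology \<Rightarrow> bool" where
  "topologically_finitely_generated G T \<longleftrightarrow>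
     (\<exists>S. finite S \<and> S \<subseteq> carrier G \<and> T closure_of (generate G S) = carrier G)"

end

(* For each x in G there is y in H such that y is in phi(X) only if x is in X, for every open
   subgroup X. Images of a finite topological generating set of G then lie in no proper open
   subgroup of H, so they generate H topologically, because the closed subgroup that they generate
   is an intersection of open subgroups.

   To find y, compactness of H reduces the condition to finitely many open subgroups X not
   containing x. Fix an open normal subgroup N contained in all of them. The exponents j with
   x^j in X are all multiples of some prime p, so each X meets <x>N in a subgroup of some
   M_p = <x^p>N. For each p in the finite set P of primes that occur, the intersection of <x>N with
   the M_q for q in P - {p} is not contained in M_p, since it contains x to the power of the product
   of P - {p}. As phi preserves inclusion and intersection, there is y_p in phi(<x>N) that lies in
   phi(M_q) for q in P - {p} but not in phi(M_p); the product of all y_p lies in no phi(M_p),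
   hence in no phi(X). *)

theory Submission
  imports Defs "HOL-Algebra.Zassenhaus" "HOL-Computational_Algebra.Primes"
begin

section \<open>Open subgroups of compact groups\<close>

locale compact_group = group G for G :: "('a, 'c) monoid_scheme" (structure) and T :: "'a topology" +
  assumes topspace_eq [simp]: "topspace T = carrier G"
    and continuous_mult: "continuous_map (prod_topology T T) T (\<lambda>(x, y). x \<otimes> y)"
    and compact: "compact_space T"
begin

lemma continuous_map_mult:
  assumes "continuous_map X T f" and "continuous_map X T g"
  shows "continuous_map X T (\<lambda>x. f x \<otimes> g x)"
proof -
  have "continuous_map X (prod_topology T T) (\<lambda>x. (f x, g x))"
    using assms by (simp add: continuous_map_paired)
  from continuous_map_compose[OF this continuous_mult] show ?thesis
    by (simp add: o_def)
qed

lemma continuous_map_left_translation: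
  assumes "g \<in> carrier G"
  shows "continuous_map T T (\<lambda>x. g \<otimes> x)"
  using assms by (intro continuous_map_mult) (auto simp: continuous_map_const)

lemma continuous_map_right_translation:
  assumes "g \<in> carrier G"
  shows "continuous_map T T (\<lambda>x. x \<otimes> g)"
  using assms by (intro continuous_map_mult) (auto simp: continuous_map_const)

text \<open>Every point x of X has the coset xN as an open neighbourhood inside X; the set
  \<open>?U\<close> is this coset, obtained as a preimage of N under left translation.\<close>

lemma open_subgroup_superset:
  assumes "openin T N" "subgroup N G" "subgroup X G" "N \<subseteq> X"
  shows "openin T X"
proof (subst openin_subopen, intro ballI)
  fix x assume x: "x \<in> X"
  then have xG: "x \<in> carrier G" using assms(3) by (rule subgroup.mem_carrier[rotated])
  let ?U = "{g \<in> topspace T. inv x \<otimes> g \<in> N}"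
  have "openin T ?U"
    using continuous_map_left_translation[of "inv x"] assms(1) xG
    by (intro openin_continuous_map_preimage) auto
  moreover have "x \<in> ?U" using xG assms(2) by (simp add: subgroup.one_closed)
  moreover have "?U \<subseteq> X"
  proof
    fix g assume g: "g \<in> ?U"
    then have "x \<otimes> (inv x \<otimes> g) \<in> X"
      using assms(3,4) x by (blast intro: subgroup.m_closed)
    then show "g \<in> X" using g xG by (simp add: m_assoc[symmetric])
  qed
  ultimately show "\<exists>U. openin T U \<and> x \<in> U \<and> U \<subseteq> X" by blast
qed

text \<open>The complement is a union of left cosets of X, and these are open.\<close>

lemma open_subgroup_closed:
  assumes "openin T X" "subgroup X G"
  shows "closedin T X"
proof -
  have "openin T (carrier G - X)"
  proof (subst openin_subopen, intro ballI)
    fix x assume x: "x \<in> carrier G - X"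
    let ?U = "{g \<in> topspace T. inv x \<otimes> g \<in> X}"
    have "openin T ?U"
      using continuous_map_left_translation[of "inv x"] assms(1) x
      by (intro openin_continuous_map_preimage) auto
    moreover have "x \<in> ?U" using x assms(2) by (simp add: subgroup.one_closed)
    moreover have "?U \<subseteq> carrier G - X"
    proof
      fix g assume g: "g \<in> ?U"
      have "x = g \<otimes> inv (inv x \<otimes> g)"
        using g x by (simp add: inv_mult_group m_assoc[symmetric])
      moreover have "inv (inv x \<otimes> g) \<in> X" using g assms(2) by (simp add: subgroup.m_inv_closed)
      ultimately have "g \<notin> X" using x assms(2) by (metis DiffD2 subgroup.m_closed)
      then show "g \<in> carrier G - X" using g by simp
    qed
    ultimately show "\<exists>U. openin T U \<and> x \<in> U \<and> U \<subseteq> carrier G - X" by blast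
  qed
  then show ?thesis
    using assms(2) by (simp add: closedin_def subgroup.subset)
qed

text \<open>Elements that can be inserted anywhere in a product without affecting membership in V
  form a normal subgroup by pure algebra, and inserting one between two identities shows that it
  lies in V. Compactness and clopenness of V serve to make this subgroup open.\<close>

lemma open_normal_subgroup_in_clopen:
  assumes "openin T V" "closedin T V" "\<one> \<in> V"
  obtains N where "N \<lhd> G" "openin T N" "N \<subseteq> V"
proof
  \<comment> \<open>The class of the identity under the syntactic congruence of V.\<close>
  define N where "N = {n \<in> carrier G. \<forall>a\<in>carrier G. \<forall>b\<in>carrier G. a \<otimes> n \<otimes> b \<in> V \<longleftrightarrow> a \<otimes> b \<in> V}"
  have mem: "a \<otimes> n \<otimes> b \<in> V \<longleftrightarrow> a \<otimes> b \<in> V" if "n \<in> N" "a \<in> carrier G" "b \<in> carrier G" for a b n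
    using that unfolding N_def by blast
  have car: "n \<in> carrier G" if "n \<in> N" for n using that by (simp add: N_def)
  have "subgroup N G"
  proof (rule subgroupI)
    show "N \<subseteq> carrier G" by (auto simp: N_def)
    have "\<one> \<in> N" by (simp add: N_def)
    then show "N \<noteq> {}" by blast
  next
    fix n assume n: "n \<in> N"
    have "a \<otimes> inv n \<otimes> b \<in> V \<longleftrightarrow> a \<otimes> b \<in> V" if "a \<in> carrier G" "b \<in> carrier G" for a b
      using mem[OF n, of "a \<otimes> inv n" b] that car[OF n] by (simp add: m_assoc l_inv)
    then show "inv n \<in> N" using car[OF n] by (simp add: N_def)
  next
    fix n m assume n: "n \<in> N" and m: "m \<in> N"
    have "a \<otimes> (n \<otimes> m) \<otimes> b \<in> V \<longleftrightarrow> a \<otimes> b \<in> V" if "a \<in> carrier G" "b \<in> carrier G" for a b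
      using mem[OF n, of a "m \<otimes> b"] mem[OF m, of a b] that car[OF n] car[OF m] by (simp add: m_assoc)
    then show "n \<otimes> m \<in> N" using car[OF n] car[OF m] by (simp add: N_def)
  qed
  then show "N \<lhd> G"
  proof (rule normal_invI)
    fix x n assume x: "x \<in> carrier G" and n: "n \<in> N"
    have "a \<otimes> (x \<otimes> n \<otimes> inv x) \<otimes> b \<in> V \<longleftrightarrow> a \<otimes> b \<in> V" if "a \<in> carrier G" "b \<in> carrier G" for a b
    proof -
      \<comment> \<open>Conjugating n by x amounts to inserting n between ax and x^-1 b, whose
        product is ab.\<close>
      have "x \<otimes> (inv x \<otimes> b) = b" using x that by (simp add: m_assoc[symmetric])
      then show ?thesis
        using mem[OF n, of "a \<otimes> x" "inv x \<otimes> b"] that car[OF n] x by (simp add: m_assoc)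
    qed
    then show "x \<otimes> n \<otimes> inv x \<in> N" using car[OF n] x by (simp add: N_def)
  qed
  show "N \<subseteq> V"
  proof
    fix n assume "n \<in> N"
    then show "n \<in> V" using mem[of n \<one> \<one>] car[of n] assms(3) by simp
  qed
  \<comment> \<open>The complement of \<open>N\<close> is the projection of a closed set along a compact factor.\<close>
  let ?P = "prod_topology (prod_topology T T) T"
  let ?f = "\<lambda>p. fst (fst p) \<otimes> snd p \<otimes> snd (fst p)" and ?g = "\<lambda>p. fst (fst p) \<otimes> snd (fst p)"
  have c: "continuous_map ?P T (\<lambda>p. fst (fst p))" "continuous_map ?P T (\<lambda>p. snd (fst p))"
      "continuous_map ?P T snd"
    using continuous_map_fst_of[OF continuous_map_fst, of T T T]
      continuous_map_snd_of[OF continuous_map_fst, of T T T]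
    by (simp_all add: o_def continuous_map_snd)
  have f: "continuous_map ?P T ?f" and g: "continuous_map ?P T ?g"
    by (intro continuous_map_mult c)+
  have V: "closedin T (carrier G - V)"
    using closedin_diff[OF closedin_topspace assms(1)] by auto
  let ?C = "{p \<in> topspace ?P. ?f p \<in> V} \<inter> {p \<in> topspace ?P. ?g p \<in> carrier G - V}
    \<union> {p \<in> topspace ?P. ?f p \<in> carrier G - V} \<inter> {p \<in> topspace ?P. ?g p \<in> V}"
  have "closedin ?P ?C"
    using V assms(2) f g
    by (intro closedin_Un closedin_Int closedin_continuous_map_preimage) auto
  then have "closedin T (snd ` ?C)"
    using closed_map_snd[of "prod_topology T T" T] compact
    by (simp add: closed_map_def compact_space_prod_topology)
  moreover have "snd ` ?C = carrier G - N"
  proof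
    show "snd ` ?C \<subseteq> carrier G - N" by (auto simp: N_def)
    show "carrier G - N \<subseteq> snd ` ?C"
    proof
      fix n assume n: "n \<in> carrier G - N"
      then obtain a b where ab: "a \<in> carrier G" "b \<in> carrier G" "(a \<otimes> n \<otimes> b \<in> V) \<noteq> (a \<otimes> b \<in> V)"
        unfolding N_def by blast
      then have "((a, b), n) \<in> ?C" using n by auto
      then show "n \<in> snd ` ?C" by (rule image_eqI[rotated]) simp
    qed
  qed
  ultimately have "openin T (carrier G - (carrier G - N))"
    by (metis closedin_def topspace_eq)
  moreover have "carrier G - (carrier G - N) = N" by (auto simp: N_def)
  ultimately show "openin T N" by simp
qed

text \<open>By compactness finitely many cosets aN cover G, so two distinct powers of x share a
  coset and their quotient is a positive power of x in N.\<close>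

lemma open_subgroup_pow:
  assumes "openin T N" "subgroup N G" "x \<in> carrier G"
  obtains m :: nat where "0 < m" "x [^] m \<in> N"
proof -
  let ?U = "\<lambda>a. {g \<in> topspace T. inv a \<otimes> g \<in> N}"
  have "openin T U" if "U \<in> ?U ` carrier G" for U
    using that    using continuous_map_left_translation assms(1)
    by (auto intro: openin_continuous_map_preimage simp del: topspace_eq)
  moreover have "topspace T \<subseteq> \<Union> (?U ` carrier G)"
    using assms(2) by (auto simp: subgroup.one_closed)
  ultimately have "\<exists>\<F>. finite \<F> \<and> \<F> \<subseteq> ?U ` carrier G \<and> topspace T \<subseteq> \<Union>\<F>"
    by (rule compactinD[OF compact[unfolded compact_space_def]])
  then obtain \<F> where \<F>: "finite \<F>" "\<F> \<subseteq> ?U ` carrier G" "topspace T \<subseteq> \<Union>\<F>"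
    by (elim exE conjE)
  from finite_subset_image[OF \<F>(1,2)]
  obtain A where A: "finite A" "A \<subseteq> carrier G" "topspace T \<subseteq> \<Union> (?U ` A)"
    using \<F>(3) by (elim exE conjE) (simp only:)
  have "\<exists>a\<in>A. inv a \<otimes> x [^] n \<in> N" for n :: nat
  proof -
    have "x [^] n \<in> topspace T" using assms(3) by simp
    then show ?thesis using A(3) by blast
  qed
  then obtain a where a: "\<And>n::nat. a n \<in> A \<and> inv (a n) \<otimes> x [^] n \<in> N" by metis
  have "\<not> inj a"
    using A(1) a by (metis finite_imageD finite_subset image_subsetI infinite_UNIV_nat)
  then obtain i j where ij: "i < j" "a i = a j"
    by (metis injI linorder_neqE_nat)
  have c: "a j \<in> carrier G" using a A(2) by blast
  have "inv (inv (a j) \<otimes> x [^] i) \<otimes> (inv (a j) \<otimes> x [^] j) \<in> N"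
    using a[of i] a[of j] ij assms(2) by (metis subgroup.m_closed subgroup.m_inv_closed)
  moreover have "x [^] j = x [^] i \<otimes> x [^] (j - i)"
    using ij assms(3) by (simp add: nat_pow_mult)
  then have "inv (inv (a j) \<otimes> x [^] i) \<otimes> (inv (a j) \<otimes> x [^] j) = x [^] (j - i)"
    using c assms(3) by (simp add: inv_mult_group m_assoc[symmetric]) (simp add: m_assoc)
  ultimately show thesis using that[of "j - i"] ij by simp
qed

end

section \<open>Open normal subgroups as a neighbourhood basis in profinite groups\<close>

lemma profinite_imp_compact_group: "profinite_group G T \<Longrightarrow> compact_group G T"
  by (simp add: profinite_group_def topological_group_def compact_group_def compact_group_axioms_def)

text \<open>In a compact Hausdorff space a component can be separated by a clopen set from any
  closed set disjoint from it. The component of the identity is trivial, so a clopen V fits between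
  it and W.\<close>

lemma profinite_group_open_normal_subgroup_basis:
  assumes "profinite_group G T" "openin T W" "\<one>\<^bsub>G\<^esub> \<in> W"
  obtains N where "N \<lhd> G" "openin T N" "N \<subseteq> W"
proof -
  interpret compact_group G T using assms(1) by (rule profinite_imp_compact_group)
  have T: "Hausdorff_space T" "totally_disconnected_space T"
    using assms(1) by (auto simp: profinite_group_def)
  have "{\<one>\<^bsub>G\<^esub>} \<in> connected_components_of T"
    using T(2) by (auto simp: connected_components_of_def totally_disconnected_space_def)
  then have "separated_between T {\<one>\<^bsub>G\<^esub>} (topspace T - W)"
    using T(1) compact assms(2,3) closedin_diff[OF closedin_topspace assms(2)]
    by (intro separated_between_compact_connected_component)
       (auto simp: compact_imp_locally_compact_space disjnt_def)
  then obtain V where "openin T V" "closedin T V" "\<one>\<^bsub>G\<^esub> \<in> V" "V \<subseteq> W"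
    unfolding separated_between by (metis Diff_mono Diff_iff closedin_subset insert_subset subset_iff)
  then show thesis
    using open_normal_subgroup_in_clopen that by (metis subset_trans)
qed

section \<open>Exponents, and products that avoid subgroups\<close>

text \<open>The exponents j with x^j in X form a subgroup of the integers. It is nonzero because of
  m, and its positive generator d is not 1 because x is outside X; any prime divisor of d will
  do.\<close>

lemma (in group) prime_dvd_exponents:
  assumes "subgroup X G" "x \<in> carrier G" "x \<notin> X" "0 < (m::nat)" "x [^] m \<in> X"
  obtains p :: nat where "prime p" "\<And>j::int. x [^] j \<in> X \<Longrightarrow> int p dvd j"
proof -
  define d where "d = (LEAST k::nat. 0 < k \<and> x [^] k \<in> X)"
  have d: "0 < d \<and> x [^] d \<in> X" unfolding d_def using assms(4,5) by (rule_tac LeastI) auto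
  have least: "\<not> (0 < k \<and> k < d \<and> x [^] k \<in> X)" for k :: nat
    unfolding d_def using not_less_Least by blast
  have "int d dvd j" if j: "x [^] j \<in> X" for j :: int
  proof -
    have "x [^] (j mod int d) = x [^] (j - int d * (j div int d))"
      by (simp add: minus_mult_div_eq_mod)
    also have "\<dots> = x [^] j \<otimes> inv ((x [^] int d) [^] (j div int d))"
      using assms(2) by (simp add: int_pow_diff int_pow_pow)
    also have "\<dots> \<in> X"
      using j d assms(1) subgroup_int_pow_closed[OF assms(1), of "x [^] d" "j div int d"]
      by (simp add: int_pow_int subgroup.m_closed subgroup.m_inv_closed)
    finally have "x [^] (nat (j mod int d)) \<in> X"
      using d by (simp flip: int_pow_int)
    then have "\<not> 0 < nat (j mod int d)"
      using least[of "nat (j mod int d)"] d by (auto simp: nat_less_iff)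
    moreover have "0 \<le> j mod int d" using d by simp
    ultimately have "j mod int d = 0" by simp
    then show ?thesis by (simp add: dvd_eq_mod_eq_0)
  qed
  moreover have "d \<noteq> 1" using d assms(2,3) by auto
  then obtain p where "prime p" "p dvd d" by (metis prime_factor_nat)
  ultimately show thesis using that[of p] by (meson dvd_trans int_dvd_int_iff)
qed

text \<open>In a product of all the y i, every factor but y i lies in A i, so the product cannot lie
  in A i. Locating z in the generated subgroup keeps it inside any subgroup that contains all the y
  i.\<close>

lemma (in group) generate_element_avoiding:
  assumes "finite I" "\<And>i. i \<in> I \<Longrightarrow> subgroup (A i) G" "\<And>i. i \<in> I \<Longrightarrow> y i \<in> carrier G - A i"
    and "\<And>i j. i \<in> I \<Longrightarrow> j \<in> I \<Longrightarrow> i \<noteq> j \<Longrightarrow> y i \<in> A j"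
  shows "\<exists>z\<in>generate G (y ` I). \<forall>i\<in>I. z \<notin> A i"
  using assms
proof (induction I rule: finite_induct)
  case empty
  then show ?case using generate.one by auto
next
  case (insert k I)
  then obtain z where z: "z \<in> generate G (y ` I)" "\<And>i. i \<in> I \<Longrightarrow> z \<notin> A i" by auto
  \<comment> \<open>The old product z lies in A k and y k does not; for i in I the roles are
    reversed. Either way the new product \<open>z \<otimes> y k\<close> has exactly one factor in
    the subgroup to be avoided.\<close>
  have sub: "generate G (y ` I) \<subseteq> A k"
    using insert by (intro generate_subgroup_incl) auto
  have zc: "z \<in> carrier G" using z(1) insert.prems(2) by (auto intro: generate_in_carrier[of "y ` I"])
  have yk: "y k \<in> carrier G" using insert.prems by auto
  have "z \<otimes> y k \<notin> A k"
  proof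
    assume "z \<otimes> y k \<in> A k"
    then have "inv z \<otimes> (z \<otimes> y k) \<in> A k"
      using z(1) sub insert.prems(1)[of k] by (blast intro: subgroup.m_closed subgroup.m_inv_closed)
    then show False using zc yk insert.prems(2)[of k] by (simp add: m_assoc[symmetric])
  qed
  moreover have "z \<otimes> y k \<notin> A i" if i: "i \<in> I" for i
  proof
    assume "z \<otimes> y k \<in> A i"
    moreover have "y k \<in> A i" using insert i by (metis insertCI)
    ultimately have "(z \<otimes> y k) \<otimes> inv (y k) \<in> A i"
      using insert.prems(1)[of i] i by (blast intro: subgroup.m_closed subgroup.m_inv_closed)
    then show False using zc yk z(2)[OF i] by (simp add: m_assoc)
  qed
  moreover have "z \<otimes> y k \<in> generate G (y ` insert k I)"
    using z(1) mono_generate[of "y ` I" "y ` insert k I"]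
    by (intro generate.eng) (auto intro: generate.incl)
  ultimately show ?case by blast
qed


section \<open>The lattice of open subgroups and its projectivities\<close>

context compact_group
begin

lemma open_subgroups_Int:
  assumes "X \<in> open_subgroups G T" "Y \<in> open_subgroups G T"
  shows "X \<inter> Y \<in> open_subgroups G T"
  using assms by (simp add: open_subgroups_def subgroups_Inter_pair openin_Int)

lemma open_subgroups_Inter:
  assumes "finite \<X>" "\<X> \<noteq> {}" "\<X> \<subseteq> open_subgroups G T"
  shows "\<Inter>\<X> \<in> open_subgroups G T"
  using assms by (induction \<X> rule: finite_ne_induct) (simp_all add: open_subgroups_Int)

lemma open_subgroups_set_mult:
  assumes "N \<lhd> G" "openin T N" "subgroup K G"
  shows "N <#> K \<in> open_subgroups G T"
proof -
  have "subgroup (N <#> K) G" using assms(1,3) by (rule mult_norm_subgroup)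
  moreover have "N \<subseteq> N <#> K"
    using assms(1,3) normal_imp_subgroup[OF assms(1)]
    by (force simp: set_mult_def dest: subgroup.one_closed subgroup.mem_carrier)
  ultimately show ?thesis
    using open_subgroup_superset[OF assms(2)] assms(1)
    by (simp add: open_subgroups_def normal_imp_subgroup)
qed

text \<open>Inclusion is the equation \<open>X \<inter> Y = X\<close>, which is carried forward by
  preservation of intersections and backward by injectivity.\<close>

lemma o_projectivity_subset_iff:
  assumes "o_projectivity G T H U \<phi>" "X \<in> open_subgroups G T" "Y \<in> open_subgroups G T"
  shows "\<phi> X \<subseteq> \<phi> Y \<longleftrightarrow> X \<subseteq> Y"
proof -
  have "\<phi> X \<subseteq> \<phi> Y \<longleftrightarrow> \<phi> (X \<inter> Y) = \<phi> X"
    using assms by (auto simp: o_projectivity_def)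
  also have "\<dots> \<longleftrightarrow> X \<inter> Y = X"
    using assms open_subgroups_Int unfolding o_projectivity_def bij_betw_def
    by (metis inj_onD)
  finally show ?thesis by auto
qed

text \<open>This is the cyclic group generated by x^q, described by exponents so that membership
  turns into divisibility.\<close>

lemma subgroup_multiple_powers:
  assumes "x \<in> carrier G"
  shows "subgroup {x [^] j | j::int. q dvd j} G"
proof (rule subgroupI)
  show "{x [^] j | j::int. q dvd j} \<subseteq> carrier G" using assms by auto
  show "{x [^] j | j::int. q dvd j} \<noteq> {}" by blast
  show "inv a \<in> {x [^] j | j::int. q dvd j}" if "a \<in> {x [^] j | j::int. q dvd j}" for a
    using that assms by (auto simp flip: int_pow_neg)
  show "a \<otimes> b \<in> {x [^] j | j::int. q dvd j}"
    if "a \<in> {x [^] j | j::int. q dvd j}" "b \<in> {x [^] j | j::int. q dvd j}" for a b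
    using that assms by (auto simp flip: int_pow_mult)
qed

lemma o_projectivity_finite_avoiding:
  assumes "group H" and \<phi>: "o_projectivity G T H U \<phi>" and x: "x \<in> carrier G"
    and F: "finite F" "F \<subseteq> {X \<in> open_subgroups G T. x \<notin> X}"
  shows "\<exists>y\<in>carrier H. \<forall>X\<in>F. y \<notin> \<phi> X"
proof -
  interpret H: group H by fact
  have XF: "subgroup X G" "openin T X" "x \<notin> X" if "X \<in> F" for X
    using that F(2) by (auto simp: open_subgroups_def)
  \<comment> \<open>Adding \<open>carrier G\<close> keeps the family nonempty when F is
    empty.\<close>
  have "\<Inter>(insert (carrier G) F) \<in> open_subgroups G T"
    using F subgroup_self openin_topspace[of T]
    by (intro open_subgroups_Inter) (auto simp: open_subgroups_def)
  then obtain N where N: "N \<lhd> G" "openin T N" "N \<subseteq> \<Inter>(insert (carrier G) F)"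
    using open_normal_subgroup_in_clopen open_subgroup_closed subgroup.one_closed
    unfolding open_subgroups_def mem_Collect_eq by metis
  have Ns: "subgroup N G" using N(1) by (rule normal_imp_subgroup)
  \<comment> \<open>A positive power of x in N lies in every X in F, which supplies the exponent
    required by \<open>prime_dvd_exponents\<close>.\<close>
  obtain m :: nat where m: "0 < m" "x [^] m \<in> N"
    using open_subgroup_pow[OF N(2) Ns x] .
  have "\<exists>p. prime p \<and> (\<forall>j::int. x [^] j \<in> X \<longrightarrow> int p dvd j)" if X: "X \<in> F" for X
  proof -
    have "x [^] m \<in> X" using m(2) N(3) X by blast
    from prime_dvd_exponents[OF XF(1)[OF X] x XF(3)[OF X] m(1) this] show ?thesis by metis
  qed
  then obtain p where p: "\<And>X. X \<in> F \<Longrightarrow> prime (p X)"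
      "\<And>X j. X \<in> F \<Longrightarrow> x [^] (j::int) \<in> X \<Longrightarrow> int (p X) dvd j"
    by metis
  \<comment> \<open>Several X may share a prime; indexing by primes instead of by members of F makes
    distinct indices coprime.\<close>
  define P where "P = p ` F"
  have finP: "finite P" using F(1) by (simp add: P_def)
  \<comment> \<open>\<open>M q\<close> is <x^q>N; in particular \<open>M 1\<close> is <x>N, the
    group in which the argument takes place.\<close>
  define M where "M q = N <#> {x [^] j | j::int. int q dvd j}" for q
  have M: "M q \<in> open_subgroups G T" for q
    unfolding M_def using N(1,2) subgroup_multiple_powers[OF x] by (rule open_subgroups_set_mult)
  have M_mem: "x [^] j \<in> M q" if "int q dvd j" for q and j :: int
    using that x subgroup.one_closed[OF Ns] unfolding M_def set_mult_def
    by (auto intro!: bexI[of _ "\<one>"])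
  have N_cancel: "b \<in> X" if "n \<in> N" "n \<otimes> b \<in> X" "b \<in> carrier G" "subgroup X G" "N \<subseteq> X" for n b X
  proof -
    have "inv n \<otimes> (n \<otimes> b) \<in> X"
      using that by (blast intro: subgroup.m_closed subgroup.m_inv_closed)
    then show ?thesis
      using that subgroup.mem_carrier[OF Ns] by (simp add: m_assoc[symmetric])
  qed
  \<comment> \<open>The converse of \<open>M_mem\<close> holds for q in P because N lies in some X
    with prime q: if x^j and x^i agree modulo N, then x^(j-i) is in X and q divides j-i.\<close>
  have M_dvd: "int q dvd j" if q: "q \<in> P" and j: "x [^] j \<in> M q" for q and j :: int
  proof -
    obtain X where X: "X \<in> F" "q = p X" using q by (auto simp: P_def)
    obtain n i where ni: "n \<in> N" "int q dvd i" "x [^] j = n \<otimes> x [^] i"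
      using j by (auto simp: M_def set_mult_def)
    have "x [^] (j - i) = n"
      using ni(1,3) x subgroup.mem_carrier[OF Ns] by (simp add: int_pow_diff m_assoc)
    then have "x [^] (j - i) \<in> X" using ni(1) N(3) X(1) by blast
    then have "int q dvd j - i" using p(2) X by blast
    then show ?thesis using ni(2) by (metis diff_add_cancel dvd_add)
  qed
  have X_M: "X \<inter> M 1 \<subseteq> M (p X)" if X: "X \<in> F" for X
  proof
    fix g assume g: "g \<in> X \<inter> M 1"
    then obtain n and j :: int where nj: "n \<in> N" "g = n \<otimes> x [^] j"
      by (auto simp: M_def set_mult_def)
    then have "x [^] j \<in> X"
      using g N_cancel[of n "x [^] j" X] XF[OF X] N(3) X x by auto
    then have "int (p X) dvd j" using p(2) X by blast
    then show "g \<in> M (p X)" using nj by (auto simp: M_def set_mult_def)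
  qed
  \<comment> \<open>The index 1 confines \<open>R q\<close> to <x>N and keeps the intersection
    nonempty as a family even if P has only one prime.\<close>
  define R where "R q = \<Inter>(M ` insert 1 (P - {q}))" for q
  have R: "R q \<in> open_subgroups G T" for q
    unfolding R_def using finP M by (intro open_subgroups_Inter) auto
  have "\<not> R q \<subseteq> M q" if q: "q \<in> P" for q
  proof -
    \<comment> \<open>The exponent is a multiple of every prime in P except q.\<close>
    let ?k = "int (\<Prod>(P - {q}))"
    have "x [^] ?k \<in> R q"
      unfolding R_def using finP by (auto intro!: M_mem dvd_prodI simp del: of_nat_prod)
    moreover have "x [^] ?k \<notin> M q"
    proof
      assume "x [^] ?k \<in> M q"
      then have "q dvd \<Prod>(P - {q})" using M_dvd[OF q] by (metis int_dvd_int_iff)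
      moreover have pr: "prime r" if "r \<in> P" for r using that p(1) by (auto simp: P_def)
      ultimately obtain r where "r \<in> P - {q}" "q dvd r"
        using prime_dvd_prod_iff[of "P - {q}" q id] finP q by auto
      then show False using pr q by (metis DiffE insertI1 primes_dvd_imp_eq)
    qed
    ultimately show ?thesis by blast
  qed
  then have "\<forall>q\<in>P. \<exists>y. y \<in> \<phi> (R q) - \<phi> (M q)"
    using o_projectivity_subset_iff[OF \<phi> R M] by blast
  then obtain y where y: "\<And>q. q \<in> P \<Longrightarrow> y q \<in> \<phi> (R q) - \<phi> (M q)" by metis
  have img: "\<phi> X \<in> open_subgroups H U" if "X \<in> open_subgroups G T" for X
    using \<phi> that by (auto simp: o_projectivity_def bij_betw_def)
  have sub: "subgroup (\<phi> (M q)) H" "subgroup (\<phi> (R q)) H" for q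
    using img[OF M] img[OF R] by (auto simp: open_subgroups_def)
  have y_M: "y q \<in> \<phi> (M r)" if "q \<in> P" "r = 1 \<or> r \<in> P" "q \<noteq> r" for q r
  proof -
    have "R q \<subseteq> M r" using that by (auto simp: R_def)
    then show ?thesis using y that o_projectivity_subset_iff[OF \<phi> R M] by blast
  qed
  have "y q \<in> carrier H - \<phi> (M q)" if "q \<in> P" for q
    using y[OF that] subgroup.mem_carrier[OF sub(2)] by blast
  then have "\<exists>z\<in>generate H (y ` P). \<forall>q\<in>P. z \<notin> \<phi> (M q)"
    using finP sub(1) y_M by (intro H.generate_element_avoiding) simp_all
  then obtain z where z: "z \<in> generate H (y ` P)" "\<And>q. q \<in> P \<Longrightarrow> z \<notin> \<phi> (M q)" by blast
  \<comment> \<open>Since 1 differs from every prime in P, \<open>y_M\<close> applies with r = 1 and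
    puts all the y q, hence z, into \<open>\<phi> (M 1)\<close>.\<close>
  have "1 \<notin> P" using p(1) not_prime_1 unfolding P_def by (metis imageE)
  then have "generate H (y ` P) \<subseteq> \<phi> (M 1)"
    using y_M sub by (intro H.generate_subgroup_incl) auto
  then have z1: "z \<in> \<phi> (M 1)" using z(1) by blast
  show ?thesis
  proof (intro bexI ballI notI)
    show "z \<in> carrier H" using z1 sub by (blast intro: subgroup.mem_carrier)
    fix X assume X: "X \<in> F" "z \<in> \<phi> X"
    have Xo: "X \<in> open_subgroups G T" using F(2) X(1) by blast
    \<comment> \<open>The image of \<open>X_M\<close>: as z is in \<open>\<phi> (M 1)\<close>, lying
      in \<open>\<phi> X\<close> would force it into \<open>\<phi> (M (p X))\<close>.\<close>
    have "\<phi> (X \<inter> M 1) \<subseteq> \<phi> (M (p X))"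
      using o_projectivity_subset_iff[OF \<phi> open_subgroups_Int[OF Xo M] M] X_M[OF X(1)] by simp
    moreover have "\<phi> (X \<inter> M 1) = \<phi> X \<inter> \<phi> (M 1)"
      using \<phi> Xo M by (simp add: o_projectivity_def)
    ultimately show False using z(2) z1 X by (auto simp: P_def)
  qed
qed

text \<open>The complements of the \<open>\<phi> X\<close> with x outside X are closed, and the
  finite case gives them the finite intersection property; compactness of H yields a common
  point.\<close>

lemma o_projectivity_avoiding:
  assumes "compact_group H U" and \<phi>: "o_projectivity G T H U \<phi>" and x: "x \<in> carrier G"
  shows "\<exists>y\<in>carrier H. \<forall>X\<in>open_subgroups G T. y \<in> \<phi> X \<longrightarrow> x \<in> X"
proof -
  interpret H: compact_group H U by fact
  let ?F = "{X \<in> open_subgroups G T. x \<notin> X}"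
  let ?C = "\<lambda>X. carrier H - \<phi> X"
  have img: "\<phi> X \<in> open_subgroups H U" if "X \<in> open_subgroups G T" for X
    using \<phi> that by (auto simp: o_projectivity_def bij_betw_def)
  \<comment> \<open>With \<open>carrier H\<close> in the family the common point belongs to H even
    if no open subgroup omits x.\<close>
  have "\<Inter>(insert (carrier H) (?C ` ?F)) \<noteq> {}"
  proof (rule H.compact[unfolded compact_space_fip, rule_format], intro conjI ballI allI impI)
    fix C assume "C \<in> insert (carrier H) (?C ` ?F)"
    then show "closedin U C"
      using img closedin_topspace[of U] closedin_diff[OF closedin_topspace, of U]
      by (auto simp: open_subgroups_def)
  next
    fix \<F> assume \<F>: "finite \<F> \<and> \<F> \<subseteq> insert (carrier H) (?C ` ?F)"
    then have "finite (\<F> - {carrier H})" "\<F> - {carrier H} \<subseteq> ?C ` ?F" by auto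
    from finite_subset_image[OF this]
    obtain F where F: "finite F" "F \<subseteq> ?F" "\<F> - {carrier H} = ?C ` F"
      by (elim exE conjE) (rule that)
    obtain y where "y \<in> carrier H" "\<forall>X\<in>F. y \<notin> \<phi> X"
      using o_projectivity_finite_avoiding[OF H.group_axioms \<phi> x F(1,2)] by blast
    then have "y \<in> \<Inter>\<F>" using F(3) by blast
    then show "\<Inter>\<F> \<noteq> {}" by blast
  qed
  then show ?thesis by blast
qed

end

section \<open>Transfer of topological generators\<close>

theorem theorem3p4:
  fixes G :: "('a, 'c) monoid_scheme" and T :: "'a topology"
    and H :: "('b, 'd) monoid_scheme" and U :: "'b topology"
  assumes "profinite_group G T" and "profinite_group H U"
    and "\<exists>\<phi>. o_projectivity G T H U \<phi>"
    and "topologically_finitely_generated G T"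
  shows "topologically_finitely_generated H U"
proof -
  interpret G: compact_group G T using assms(1) by (rule profinite_imp_compact_group)
  interpret H: compact_group H U using assms(2) by (rule profinite_imp_compact_group)
  obtain \<phi> where \<phi>: "o_projectivity G T H U \<phi>" using assms(3) by blast
  obtain S where S: "finite S" "S \<subseteq> carrier G" "T closure_of (generate G S) = carrier G"
    using assms(4) by (auto simp: topologically_finitely_generated_def)
  have "\<forall>s\<in>S. \<exists>y\<in>carrier H. \<forall>X\<in>open_subgroups G T. y \<in> \<phi> X \<longrightarrow> s \<in> X"
    using G.o_projectivity_avoiding[OF H.compact_group_axioms \<phi>] S(2) by blast
  then obtain f where f: "\<And>s. s \<in> S \<Longrightarrow> f s \<in> carrier H"
      "\<And>s X. s \<in> S \<Longrightarrow> X \<in> open_subgroups G T \<Longrightarrow> f s \<in> \<phi> X \<Longrightarrow> s \<in> X"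
    by metis
  have fS: "f ` S \<subseteq> carrier H" using f(1) by blast
  have gen: "subgroup (generate H (f ` S)) H" using fS by (rule H.generate_is_subgroup)
  have full: "B = carrier H" if B: "B \<in> open_subgroups H U" "f ` S \<subseteq> B" for B
  proof -
    have surj: "\<phi> ` open_subgroups G T = open_subgroups H U"
      using \<phi> by (simp add: o_projectivity_def bij_betw_def)
    then obtain X where X: "X \<in> open_subgroups G T" "B = \<phi> X" using B(1) by blast
    have Xs: "subgroup X G" "openin T X" using X(1) by (auto simp: open_subgroups_def)
    have "S \<subseteq> X" using f(2) X B(2) by blast
    then have "generate G S \<subseteq> X" using Xs(1) by (rule G.generate_subgroup_incl)
    then have "carrier G \<subseteq> X"
      using S(3) G.open_subgroup_closed[OF Xs(2,1)] by (metis closure_of_minimal)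
    \<comment> \<open>The subgroup Y mapped to \<open>carrier H\<close> lies in G and so in X;
      monotonicity then gives that \<open>carrier H\<close> lies in B.\<close>
    moreover have "carrier H \<in> open_subgroups H U"
      using H.subgroup_self openin_topspace[of U] by (simp add: open_subgroups_def)
    then obtain Y where Y: "Y \<in> open_subgroups G T" "carrier H = \<phi> Y" using surj by blast
    moreover have "Y \<subseteq> carrier G" using Y(1) by (auto simp: open_subgroups_def dest: subgroup.subset)
    ultimately have "carrier H \<subseteq> B"
      using G.o_projectivity_subset_iff[OF \<phi> Y(1) X(1)] X(2) by auto
    then show ?thesis using B(1) by (auto simp: open_subgroups_def dest: subgroup.subset)
  qed
  \<comment> \<open>Density: if Nh lies in W, then N times the subgroup generated by
    \<open>f\<close> S\<open>is open and contains\<close>f \<open>S\<close>, so it is H by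
    \<open>full\<close>. Writing h = ns with n in N puts s = n^-1 h into Nh and thus into W.\<close>
  have "h \<in> U closure_of (generate H (f ` S))" if h: "h \<in> carrier H" for h
    unfolding in_closure_of
  proof (intro conjI allI impI)
    show "h \<in> topspace U" using h by simp
    fix W assume W: "h \<in> W \<and> openin U W"
    \<comment> \<open>Right translation by h turns W into the neighbourhood W h^-1 of the
      identity.\<close>
    have "openin U {v \<in> topspace U. v \<otimes>\<^bsub>H\<^esub> h \<in> W}"
      using W by (intro openin_continuous_map_preimage[OF H.continuous_map_right_translation[OF h]]) blast
    moreover have "\<one>\<^bsub>H\<^esub> \<in> {v \<in> topspace U. v \<otimes>\<^bsub>H\<^esub> h \<in> W}" using W h by simp
    ultimately obtain N where N: "N \<lhd> H" "openin U N" "N \<subseteq> {v \<in> topspace U. v \<otimes>\<^bsub>H\<^esub> h \<in> W}"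
      by (rule profinite_group_open_normal_subgroup_basis[OF assms(2)])
    have Ns: "subgroup N H" using N(1) by (rule normal_imp_subgroup)
    have "f ` S \<subseteq> N <#>\<^bsub>H\<^esub> generate H (f ` S)"
      using fS subgroup.one_closed[OF Ns] generate.incl[of _ "f ` S" H]
      by (force simp: set_mult_def)
    then have "h \<in> N <#>\<^bsub>H\<^esub> generate H (f ` S)"
      using full[OF H.open_subgroups_set_mult[OF N(1,2) gen]] h by simp
    then obtain n s where ns: "n \<in> N" "s \<in> generate H (f ` S)" "h = n \<otimes>\<^bsub>H\<^esub> s"
      by (auto simp: set_mult_def)
    have "n \<in> carrier H" "s \<in> carrier H"
      using ns Ns gen by (auto intro: subgroup.mem_carrier)
    then have "s = inv\<^bsub>H\<^esub> n \<otimes>\<^bsub>H\<^esub> h" using ns(3) by (simp add: H.m_assoc[symmetric])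
    moreover have "inv\<^bsub>H\<^esub> n \<in> N" using ns(1) Ns by (simp add: subgroup.m_inv_closed)
    ultimately have "s \<in> W" using N(3) by blast
    then show "\<exists>s. s \<in> generate H (f ` S) \<and> s \<in> W" using ns(2) by blast
  qed
  then have "U closure_of (generate H (f ` S)) = carrier H"
    using closure_of_subset_topspace[of U] by auto
  then show ?thesis
    using S(1) fS unfolding topologically_finitely_generated_def by blast
qed

end
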